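(* Let $M$ be a complex matrix of order $n$, partitioned as a $k\times k$ block matrix with all blocks square of dimension $n/k$, and let $M=M_D+M_{\mathrm{off}}$ be its decomposition into the block diagonal part $M_D$ and the block off-diagonal part $M_{\mathrm{off}}$. Suppose $M_D$ is non-singular, $\rho(M_D^{-1}M_{\mathrm{off}})<1$, and $M_{\mathrm{off}}$ is an odd checkerboard matrix with regard to the block size $n/k$. Let $\delta_0\equiv\ln(\det(M_D))$ and, for $m\ge1$, $$\delta_m\equiv\ln(\det(M_D))+\sum_{p=1}^m\frac{(-1)^{p-1}}{p}\,\mathrm{trace}\big((M_D^{-1}M_{\mathrm{off}})^p\big).$$ Then for all $m\ge 1$, $$\delta_m=\begin{cases}\delta_{m-1} & \text{if } m \text{ is odd},\\[2pt] \delta_{m-2}-\dfrac{\mathrm{trace}\big((M_D^{-1}M_{\mathrm{off}})^m\big)}{m} & \text{if } m\text{ is even}.\end{cases}$$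
   Context: $\rho(A)=\max_j|\lambda_j(A)|$ is the spectral radius of a square matrix $A$ with eigenvalues $\lambda_j(A)$. Given a block partition $(M_{ij})_{1\le i,j\le k}$ of $M$, $M_D$ is the block diagonal matrix with diagonal blocks $M_{11},\dots,M_{kk}$ and zero off-diagonal blocks, and $M_{\mathrm{off}}=M-M_D$. A matrix partitioned into $k\times k$ equally sized square blocks $N_{ij}$ of dimension $n/k$ is an odd checkerboard matrix (with regard to the block size $n/k$) if $N_{ij}=0$ whenever $i$ and $j$ are both even or both odd, $1\le i,j\le k$. $\ln(\det(M_D))$ is a fixed value of the complex logarithm of $\det(M_D)$, the same in every $\delta_m$. *)

theory Defs
  imports
    "Jordan_Normal_Form.Gauss_Jordan_Elimination"
    "Jordan_Normal_Form.Spectral_Radius"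
begin

text \<open>Blocks are indexed by \<open>{0..<k}\<close>, in keeping with the 0-based matrix indices of the library.
  Shifting both block indices by one swaps ``both even'' and ``both odd'', so the checkerboard
  condition below is the same for the numbering \<open>{1..k}\<close>.\<close>

definition mat_block :: "nat \<Rightarrow> 'a mat \<Rightarrow> nat \<Rightarrow> nat \<Rightarrow> 'a mat" where
  "mat_block s M i j = mat s s (\<lambda>(r, c). M $$ (i * s + r, j * s + c))"

definition block_diag_part :: "nat \<Rightarrow> nat \<Rightarrow> 'a :: zero mat \<Rightarrow> 'a mat" where
  "block_diag_part k s M = diag_block_mat (map (\<lambda>i. mat_block s M i i) [0..<k])"

definition block_off_part :: "nat \<Rightarrow> nat \<Rightarrow> 'a :: ring mat \<Rightarrow> 'a mat" where
  "block_off_part k s M = M - block_diag_part k s M"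

definition odd_checkerboard :: "nat \<Rightarrow> nat \<Rightarrow> 'a :: zero mat \<Rightarrow> bool" where
  "odd_checkerboard k s N \<longleftrightarrow>
     N \<in> carrier_mat (k * s) (k * s) \<and>
     (\<forall>i<k. \<forall>j<k. (even i \<and> even j) \<or> (odd i \<and> odd j) \<longrightarrow> mat_block s N i j = 0\<^sub>m s s)"

definition mat_trace :: "'a :: comm_monoid_add mat \<Rightarrow> 'a" where
  "mat_trace A = (\<Sum>i<dim_row A. A $$ (i, i))"

text \<open>\<open>M\<^sub>D\<^sup>-\<^sup>1 M\<^sub>o\<^sub>f\<^sub>f\<close>; \<open>mat_inverse\<close> returns \<open>Some\<close> of the inverse for every invertible matrix,
  so this is only meaningful when the block diagonal part is invertible.\<close>

definition diag_inv_off :: "nat \<Rightarrow> nat \<Rightarrow> 'a :: field mat \<Rightarrow> 'a mat" where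
  "diag_inv_off k s M = the (mat_inverse (block_diag_part k s M)) * block_off_part k s M"

text \<open>The parameter \<open>l\<close> stands for the chosen value of the logarithm of the determinant of the
  block diagonal part, i.e. any complex number with \<open>exp l = det (block_diag_part k s M)\<close>.\<close>

definition delta :: "nat \<Rightarrow> nat \<Rightarrow> complex mat \<Rightarrow> complex \<Rightarrow> nat \<Rightarrow> complex" where
  "delta k s M l m =
     l + (\<Sum>p = 1..m. (-1) ^ (p - 1) / of_nat p * mat_trace (diag_inv_off k s M ^\<^sub>m p))"

end

theory Submission
  imports Defs
begin

text \<open>Let \<open>S\<close> be the diagonal matrix whose \<open>i\<close>-th block is \<open>(-1)\<^sup>i\<close> times the identity. It commutes
  with \<open>M\<^sub>D\<close>, hence with its inverse, and anticommutes with the odd checkerboard matrix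
  \<open>M\<^sub>o\<^sub>f\<^sub>f\<close>. So \<open>S\<close> anticommutes with every odd power of \<open>A = M\<^sub>D\<^sup>-\<^sup>1 M\<^sub>o\<^sub>f\<^sub>f\<close>; comparing diagonal
  entries, such a power has zero diagonal, and the odd terms of the sum vanish.\<close>

text \<open>Induction on the list: \<open>diag_block_mat\<close> puts the head in the top left
  corner and the rest in the bottom right one, so indices beyond the first block are shifted down by
  \<open>s\<close>.\<close>

lemma index_diag_block_mat_equal_size:
  fixes As :: "'a :: zero mat list"
  assumes "\<forall>A \<in> set As. A \<in> carrier_mat s s" and "i < length As * s" and "j < length As * s"
  shows "diag_block_mat As $$ (i, j) =
    (if i div s = j div s then (As ! (i div s)) $$ (i mod s, j mod s) else 0)"
  using assms
proof (induction As arbitrary: i j)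
  case Nil
  then show ?case by simp
next
  case (Cons A As)
  have s: "0 < s" using Cons.prems(2) by (cases s) auto
  have A: "dim_row A = s" "dim_col A = s" using Cons.prems(1) by auto
  have "map dim_row As = map (\<lambda>_. s) As" "map dim_col As = map (\<lambda>_. s) As"
    using Cons.prems(1) by auto
  then have D: "dim_row (diag_block_mat As) = length As * s" "dim_col (diag_block_mat As) = length As * s"
    by (simp_all only: dim_diag_block_mat sum_list_triv of_nat_id)
  \<comment> \<open>Skipping the first block lowers the block number by one and keeps the position
    inside the block.\<close>
  have shift: "x div s = Suc ((x - s) div s)" "x mod s = (x - s) mod s" if "\<not> x < s" for x
    using that s by (simp_all add: le_div_geq le_mod_geq)
  have IH: "diag_block_mat As $$ (i - s, j - s) =
      (if (i - s) div s = (j - s) div s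
       then (As ! ((i - s) div s)) $$ ((i - s) mod s, (j - s) mod s) else 0)"
    if "\<not> i < s" "\<not> j < s"
    using Cons.prems that by (intro Cons.IH) auto
  show ?case
  proof (cases "i < s"; cases "j < s")
  qed (use Cons.prems(2,3) IH shift[of i] shift[of j] in \<open>simp_all add: A D Let_def\<close>)
qed

lemma dim_block_diag_part: "block_diag_part k s M \<in> carrier_mat (k * s) (k * s)"
  by (auto simp: block_diag_part_def dim_diag_block_mat o_def mat_block_def sum_list_triv)

lemma index_block_diag_part:
  assumes "i < k * s" and "j < k * s"
  shows "block_diag_part k s M $$ (i, j) = (if i div s = j div s then M $$ (i, j) else 0)"
proof -
  have s: "0 < s" using assms(1) by (cases s) auto
  have "i div s < k" using assms(1) s by (simp add: div_less_iff_less_mult)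
  moreover have "mat_block s M (i div s) (i div s) $$ (i mod s, j mod s) = M $$ (i, j)"
    if "i div s = j div s"
  proof -
    \<comment> \<open>The column offset of the block is computed from \<open>i\<close>; it fits
      \<open>j\<close> because both indices lie in the same block.\<close>
    have "i div s * s + j mod s = j" unfolding that by simp
    then show ?thesis using s by (simp add: mat_block_def)
  qed
  ultimately show ?thesis unfolding block_diag_part_def
    using assms by (subst index_diag_block_mat_equal_size[where s = s]) (auto simp: mat_block_def)
qed

lemma odd_checkerboard_index:
  assumes "odd_checkerboard k s N" and "i < k * s" and "j < k * s"
    and "even (i div s) = even (j div s)"
  shows "N $$ (i, j) = 0"
proof -
  have s: "0 < s" using assms(2) by (cases s) auto
  have "i div s < k" "j div s < k" using assms(2,3) s by (simp_all add: div_less_iff_less_mult)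
  then have "mat_block s N (i div s) (j div s) = 0\<^sub>m s s"
    using assms(1,4) by (auto simp: odd_checkerboard_def)
  then have "mat_block s N (i div s) (j div s) $$ (i mod s, j mod s) = 0" using s by simp
  then show ?thesis using s by (simp add: mat_block_def)
qed

text \<open>The signature matrix that grades the indices by the parity of their block.\<close>

definition block_sign_mat :: "nat \<Rightarrow> nat \<Rightarrow> 'a :: comm_ring_1 mat" where
  "block_sign_mat n s = mat_diag n (\<lambda>i. (-1) ^ (i div s))"

lemma block_sign_mat_carrier [simp]: "block_sign_mat n s \<in> carrier_mat n n"
  by (simp add: block_sign_mat_def)

text \<open>Row and column scaling agree inside a diagonal block, where both signs come from the
  same block number; all other entries are zero.\<close>

lemma block_sign_mat_commute_block_diag_part:
  "block_sign_mat (k * s) s * block_diag_part k s M = block_diag_part k s M * block_sign_mat (k * s) s"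
  unfolding block_sign_mat_def
    mat_diag_mult_left[OF dim_block_diag_part] mat_diag_mult_right[OF dim_block_diag_part]
  by (rule eq_matI) (auto simp: index_block_diag_part)

text \<open>A nonzero entry of \<open>N\<close> joins blocks of opposite parity, so its row sign and
  its column sign are opposite.\<close>

lemma block_sign_mat_anticommute_odd_checkerboard:
  assumes "odd_checkerboard k s N"
  shows "block_sign_mat (k * s) s * N = - (N * block_sign_mat (k * s) s)"
proof -
  have N: "N \<in> carrier_mat (k * s) (k * s)" using assms by (simp add: odd_checkerboard_def)
  have "(-1) ^ (i div s) * N $$ (i, j) = - (N $$ (i, j) * (-1) ^ (j div s))"
    if "i < k * s" "j < k * s" for i j
    using odd_checkerboard_index[OF assms that]
    by (cases "even (i div s)"; cases "even (j div s)") auto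
  then show ?thesis
    unfolding block_sign_mat_def mat_diag_mult_left[OF N] mat_diag_mult_right[OF N]
    by (intro eq_matI) auto
qed

text \<open>Multiply \<open>S * D = D * S\<close> by \<open>E\<close> from both sides and
  cancel.\<close>

lemma inverse_mat_commute:
  fixes S :: "'a :: semiring_1 mat"
  assumes S: "S \<in> carrier_mat n n" and D: "D \<in> carrier_mat n n" and E: "E \<in> carrier_mat n n"
    and "D * E = 1\<^sub>m n" and "E * D = 1\<^sub>m n" and "S * D = D * S"
  shows "S * E = E * S"
proof -
  have "S * E = (E * D) * (S * E)" using assms by simp
  also have "\<dots> = E * ((D * S) * E)" using S D E by (simp add: assoc_mult_mat[of _ n n _ n _ n])
  also have "\<dots> = E * (S * D * E)" using assms by simp
  also have "\<dots> = (E * S) * (D * E)" using S D E by (simp add: assoc_mult_mat[of _ n n _ n _ n])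
  also have "\<dots> = E * S" using assms by simp
  finally show ?thesis .
qed

text \<open>Moving \<open>S\<close> past each of the \<open>p\<close> factors costs one
  sign.\<close>

lemma anticommute_mat_pow:
  fixes S A :: "'a :: comm_ring_1 mat"
  assumes S: "S \<in> carrier_mat n n" and A: "A \<in> carrier_mat n n" and SA: "S * A = - (A * S)"
  shows "S * A ^\<^sub>m p = (-1) ^ p \<cdot>\<^sub>m (A ^\<^sub>m p * S)"
proof (induction p)
  case 0
  have "1 \<cdot>\<^sub>m S = S" by (rule eq_matI) auto
  then show ?case using S A by simp
next
  case (Suc p)
  have P: "A ^\<^sub>m p \<in> carrier_mat n n" using A by simp
  have "S * A ^\<^sub>m Suc p = (S * A ^\<^sub>m p) * A" using S A P by (simp add: assoc_mult_mat[of _ n n _ n _ n])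
  also have "\<dots> = (-1) ^ p \<cdot>\<^sub>m (A ^\<^sub>m p * (S * A))"
    unfolding Suc.IH mult_smult_assoc_mat[OF mult_carrier_mat[OF P S] A] assoc_mult_mat[OF P S A] ..
  also have "\<dots> = (-1) ^ p \<cdot>\<^sub>m - (A ^\<^sub>m Suc p * S)"
    unfolding SA using S A P by (simp add: assoc_mult_mat[of _ n n _ n _ n])
  also have "\<dots> = (-1) ^ Suc p \<cdot>\<^sub>m (A ^\<^sub>m Suc p * S)" by (rule eq_matI) auto
  finally show ?case .
qed

text \<open>On the diagonal, row and column signs coincide, so each entry equals its own negative
  and vanishes in characteristic zero.\<close>

lemma mat_trace_eq_0_if_anticommute_block_sign_mat:
  fixes B :: "'a :: field_char_0 mat"
  assumes B: "B \<in> carrier_mat n n" and "block_sign_mat n s * B = - (B * block_sign_mat n s)"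
  shows "mat_trace B = 0"
proof -
  have "B $$ (i, i) = 0" if "i < n" for i
  proof -
    have "(block_sign_mat n s * B) $$ (i, i) = (- (B * block_sign_mat n s)) $$ (i, i)"
      using assms(2) by simp
    then have "(-1) ^ (i div s) * B $$ (i, i) = - (B $$ (i, i) * (-1) ^ (i div s))"
      unfolding block_sign_mat_def mat_diag_mult_left[OF B] mat_diag_mult_right[OF B]
      using that by simp
    then show ?thesis by (cases "even (i div s)") auto
  qed
  then show ?thesis using B by (simp add: mat_trace_def)
qed

text \<open>Ensures that \<open>the (mat_inverse ...)\<close> in \<open>diag_inv_off\<close> is a
  genuine two-sided inverse, by passing through the units of the matrix ring.\<close>

lemma mat_inverse_invertible:
  fixes A :: "'a :: field mat"
  assumes A: "A \<in> carrier_mat n n" and "invertible_mat A"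
  obtains E where "mat_inverse A = Some E" "A * E = 1\<^sub>m n" "E * A = 1\<^sub>m n" "E \<in> carrier_mat n n"
proof -
  obtain B where AB: "A * B = 1\<^sub>m n" and BA: "B * A = 1\<^sub>m (dim_row B)"
    using assms by (auto simp: invertible_mat_def inverts_mat_def)
  \<comment> \<open>Invertibility does not state the size of \<open>B\<close>; it is read off from
    the column counts of the two products.\<close>
  have "dim_col B = n" using arg_cong[OF AB, of dim_col] by simp
  moreover have "dim_row B = n" using arg_cong[OF BA, of dim_col] A by simp
  ultimately have "A \<in> Units (ring_mat TYPE('a) n ())"
    using A AB BA by (auto simp: Units_def ring_mat_def)
  then have "mat_inverse A \<noteq> None" using mat_inverse(1)[OF A] by metis
  then obtain E where "mat_inverse A = Some E" by blast
  then show ?thesis using mat_inverse(2)[OF A] that by blast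
qed

lemma mat_trace_diag_inv_off_odd_pow:
  fixes M :: "'a :: field_char_0 mat"
  assumes "invertible_mat (block_diag_part k s M)"
    and "odd_checkerboard k s (block_off_part k s M)" and "odd p"
  shows "mat_trace (diag_inv_off k s M ^\<^sub>m p) = 0"
proof -
  let ?n = "k * s" and ?S = "block_sign_mat (k * s) s :: 'a mat"
  let ?D = "block_diag_part k s M" and ?N = "block_off_part k s M" and ?A = "diag_inv_off k s M"
  obtain E where E: "mat_inverse ?D = Some E" "?D * E = 1\<^sub>m ?n" "E * ?D = 1\<^sub>m ?n"
      "E \<in> carrier_mat ?n ?n"
    using mat_inverse_invertible[OF dim_block_diag_part assms(1)] .
  have N: "?N \<in> carrier_mat ?n ?n" using assms(2) by (simp add: odd_checkerboard_def)
  have A_eq: "?A = E * ?N" by (simp add: diag_inv_off_def E(1))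
  then have A: "?A \<in> carrier_mat ?n ?n" using E(4) N by simp
  have SE: "?S * E = E * ?S"
    by (rule inverse_mat_commute[OF block_sign_mat_carrier dim_block_diag_part E(4,2,3)
          block_sign_mat_commute_block_diag_part])
  \<comment> \<open>\<open>?S\<close> passes \<open>E\<close> freely and picks up a sign at
    \<open>?N\<close>, hence it anticommutes with the product \<open>?A\<close>.\<close>
  have "?S * ?A = (?S * E) * ?N"
    unfolding A_eq by (rule assoc_mult_mat[symmetric, OF block_sign_mat_carrier E(4) N])
  also have "\<dots> = E * (?S * ?N)"
    unfolding SE by (rule assoc_mult_mat[OF E(4) block_sign_mat_carrier N])
  also have "\<dots> = - (E * (?N * ?S))"
    unfolding block_sign_mat_anticommute_odd_checkerboard[OF assms(2)]
    using E(4) N by (intro uminus_mult_right_mat) (simp add: carrier_matD)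
  also have "E * (?N * ?S) = ?A * ?S"
    unfolding A_eq by (rule assoc_mult_mat[symmetric, OF E(4) N block_sign_mat_carrier])
  finally have "?S * ?A ^\<^sub>m p = (-1) ^ p \<cdot>\<^sub>m (?A ^\<^sub>m p * ?S)"
    by (intro anticommute_mat_pow[OF _ A]) simp_all
  also have "\<dots> = - (?A ^\<^sub>m p * ?S)" using \<open>odd p\<close> by (intro eq_matI) auto
  finally show ?thesis
    using A by (intro mat_trace_eq_0_if_anticommute_block_sign_mat) auto
qed

text \<open>The new summand has index \<open>Suc m\<close>, so its sign exponent
  \<open>p - 1\<close> is \<open>m\<close>.\<close>

lemma delta_Suc:
  "delta k s M l (Suc m) =
    delta k s M l m + (-1) ^ m / of_nat (Suc m) * mat_trace (diag_inv_off k s M ^\<^sub>m Suc m)"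
  by (simp add: delta_def)

theorem theorem2p7:
  fixes M :: "complex mat" and n k :: nat and l :: complex
  assumes "0 < n" and "0 < k" and "k dvd n"
    and "M \<in> carrier_mat n n"
    and "invertible_mat (block_diag_part k (n div k) M)"
    and "spectral_radius (diag_inv_off k (n div k) M) < 1"
    and "odd_checkerboard k (n div k) (block_off_part k (n div k) M)"
    and "exp l = det (block_diag_part k (n div k) M)"
  shows "\<forall>m\<ge>1. delta k (n div k) M l m =
    (if odd m then delta k (n div k) M l (m - 1)
     else delta k (n div k) M l (m - 2)
            - mat_trace (diag_inv_off k (n div k) M ^\<^sub>m m) / of_nat m)"
proof -
  note tr0 = mat_trace_diag_inv_off_odd_pow[OF assms(5,7)]
  have odd_step: "delta k (n div k) M l (Suc m) = delta k (n div k) M l m" if "even m" for m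
    unfolding delta_Suc using tr0[of "Suc m"] that by simp
  show ?thesis
  proof (intro allI impI)
    fix m :: nat
    assume "1 \<le> m"
    show "delta k (n div k) M l m =
      (if odd m then delta k (n div k) M l (m - 1)
       else delta k (n div k) M l (m - 2)
            - mat_trace (diag_inv_off k (n div k) M ^\<^sub>m m) / of_nat m)"
    proof (cases "odd m")
      case True
      then show ?thesis using odd_step[of "m - 1"] \<open>1 \<le> m\<close> by simp
    next
      case False
      \<comment> \<open>An even \<open>m\<close> that is positive is at least 2, so the truncated
        subtraction \<open>m - 2\<close> is exact.\<close>
      then have "1 < m" using \<open>1 \<le> m\<close> by (cases "m = 1") auto
      then obtain q where "m = Suc (Suc q)" by (auto dest: less_imp_Suc_add)
      with False have q: "m = Suc (Suc q)" "even q" by simp_all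
      have "delta k (n div k) M l m = delta k (n div k) M l q
          - mat_trace (diag_inv_off k (n div k) M ^\<^sub>m m) / of_nat m"
        \<comment> \<open>Two indices are peeled off: the even one contributes its trace with sign
          \<open>(-1) ^ Suc q\<close>, which is -1, and the odd one \<open>Suc q\<close> contributes
          nothing.\<close>
        unfolding q(1) delta_Suc[of _ _ _ _ "Suc q"] odd_step[OF q(2)]
        using q(2) by (simp del: pow_mat.simps of_nat_Suc)
      then show ?thesis using False q(1) by (simp del: pow_mat.simps of_nat_Suc)
    qed
  qed
qed

end
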